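(* Suppose that the partition function $\xi$ is strictly convex. Let $M\subseteq[d]$ with cardinality $s$ be such that $\mathbf X_M$ has full column rank, and let $S_M\in\{-1,1\}^s$. Then $E_M^{S_M}$ is equal to the set of all $Y\in\mathcal Y^N$ such that $\rho:=-\lambda S_M+\mathbf X_M^{\top}Y$ satisfies (a) $\rho\in\mathrm{Im}(\Xi)$; (b) $\mathrm{Diag}(S_M)\,\Psi(\rho)\geq 0$ (entrywise); (c) $\left\|\mathbf X_{-M}^{\top}\left(Y-\sigma(\mathbf X_M\Psi(\rho))\right)\right\|_{\infty}<\lambda$.
   Context: Setting (generalized linear model and $\ell_1$-penalized estimator). $N,d\ge1$ are integers, $[d]=\{1,\dots,d\}$, $\Theta\subseteq\mathbb R^d$, $\mathcal Y\subseteq\mathbb R$, $\lambda>0$, $v>0$. $\mathbf X\in\mathbb R^{N\times d}$ is a fixed design matrix with rows $\mathbf x_1,\dots,\mathbf x_N$. The function $\xi:\mathbb R\to\mathbb R$ is of class $\mathcal C^{m+1}$ ($m\ge0$ an integer) and is the partition function of an exponential family: for $\vartheta\in\Theta$, the response $y\in\mathcal Y$ given the covariate $\mathbf x$ has density $h_v(y)\exp\{(y\langle\mathbf x,\vartheta\rangle-\xi(\langle\mathbf x,\vartheta\rangle))/v\}$, and for every $t\in\mathbb R$ the function $y\mapsto h_v(y)\exp\{(yt-\xi(t))/v\}$ is a probability density on $\mathcal Y$. Put $\sigma=\xi'$, applied entrywise to vectors. For $Y=(y_1,\dots,y_N)\in\mathcal Y^N$, the generalized linear lasso is any $\hat\vartheta^{\lambda}\in\arg\min_{\vartheta\in\Theta}\{\sum_{i=1}^N(\xi(\langle\mathbf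 x_i,\vartheta\rangle)-y_i\langle\mathbf x_i,\vartheta\rangle)+\lambda\|\vartheta\|_1\}$. It is assumed that such solutions exist and are exactly the $\hat\vartheta^\lambda\in\Theta$ for which there is $\widehat S\in\mathbb R^d$ satisfying the KKT conditions: $\mathbf X^{\top}(Y-\sigma(\mathbf X\hat\vartheta^{\lambda}))=\lambda\widehat S$; $\widehat S_k=\mathrm{sign}(\hat\vartheta^\lambda_k)$ if $\hat\vartheta^\lambda_k\ne0$; $\widehat S_k\in[-1,1]$ if $\hat\vartheta^\lambda_k=0$. When $\xi$ is strictly convex, the vector $\widehat S(Y):=\frac1\lambda\mathbf X^\top(Y-\sigma(\mathbf X\hat\vartheta^\lambda))$ does not depend on the chosen solution. The equicorrelation set is $\widehat M(Y)=\{k\in[d]:|\widehat S_k(Y)|=1\}$. Standing assumption (non-degeneracy): $\widehat S(Y)$ lies in the relative interior of the subdifferential of $\|\cdot\|_1$ at $\hat\vartheta^\lambda$, i.e. $|\widehat S_k(Y)|<1$ whenever $\hat\vartheta^\lambda_k=0$, so that $\widehat M(Y)$ is the support of $\hat\vartheta^\lambda$. For $M\subseteq[d]$: $v_M=(v_k)_{k\in M}$; $\mathbf X_M$ (resp. $\mathbf X_{-M}$) is the submatrix of $\mathbf X$ keeping the columns indexed by $M$ (resp. by $[d]\setminus M$); $\Theta_M=\{\vartheta_M:\vartheta\in\Theta\}\subseteq\mathbb R^s$; $E_M=\{Y\in\mathcal Y^N:\widehat M(Y)=M\}$; and for $S_M\in\{-1,1\}^s$, $E_M^{S_M}=\{Y\in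 E_M:\widehat S_M(Y)=S_M\}$ where $\widehat S_M(Y)=(\widehat S_k(Y))_{k\in M}$. The map $\Xi:\Theta_M\to\mathbb R^s$ is $\Xi(\theta)=\mathbf X_M^\top\sigma(\mathbf X_M\theta)$; when $\xi$ is strictly convex and $\mathbf X_M$ has full column rank it is injective, and $\Psi:\mathrm{Im}(\Xi)\to\Theta_M$ denotes its inverse. *)

theory Defs
  imports "HOL-Probability.Probability"
begin

section \<open>Functions of one real variable\<close>

definition C_class :: "nat \<Rightarrow> (real \<Rightarrow> real) \<Rightarrow> bool" where
  "C_class n f \<longleftrightarrow>
     (\<forall>k<n. \<forall>x. (deriv ^^ k) f differentiable (at x)) \<and> continuous_on UNIV ((deriv ^^ n) f)"

definition strictly_convex :: "(real \<Rightarrow> real) \<Rightarrow> bool" where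
  "strictly_convex f \<longleftrightarrow>
     (\<forall>x y t. x \<noteq> y \<longrightarrow> 0 < t \<longrightarrow> t < 1 \<longrightarrow> f ((1 - t) * x + t * y) < (1 - t) * f x + t * f y)"

text \<open>The reference measure \<open>\<nu>\<close> on \<open>\<Y>\<close> is arbitrary, so that both discrete and continuous
  responses are covered.\<close>

definition partition_function ::
  "real set \<Rightarrow> real measure \<Rightarrow> (real \<Rightarrow> real) \<Rightarrow> real \<Rightarrow> (real \<Rightarrow> real) \<Rightarrow> bool" where
  "partition_function \<Y> \<nu> h v \<xi> \<longleftrightarrow>
     sets \<nu> = sets (restrict_space borel \<Y>) \<and> h \<in> borel_measurable \<nu> \<and> (\<forall>y\<in>\<Y>. 0 \<le> h y) \<and>
     (\<forall>t. prob_space (density \<nu> (\<lambda>y. ennreal (h y * exp ((y * t - \<xi> t) / v)))))"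


section \<open>Vectors and submatrices indexed by a set of coordinates\<close>

text \<open>With \<open>s = card M\<close>, an element of \<open>\<real>\<^sup>s\<close> is a family indexed by \<open>M\<close>, that is a function which is
  \<^term>\<open>undefined\<close> outside of \<open>M\<close>; the empty \<open>M\<close> is allowed.\<close>

definition subvec :: "'d set \<Rightarrow> real ^ 'd \<Rightarrow> 'd \<Rightarrow> real" where
  "subvec M w = (\<lambda>k\<in>M. w $ k)"

text \<open>The products of a vector with \<open>X\<^sub>M\<close> and with its transpose, where \<open>X\<^sub>M\<close> consists of the columns of
  \<open>X\<close> indexed by \<open>M\<close>.\<close>

definition submat_mult :: "real ^ 'd ^ 'n \<Rightarrow> 'd set \<Rightarrow> ('d \<Rightarrow> real) \<Rightarrow> real ^ 'n" where
  "submat_mult X M \<eta> = (\<chi> i. \<Sum>k\<in>M. X $ i $ k * \<eta> k)"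

definition submat_tmult :: "real ^ 'd ^ 'n \<Rightarrow> 'd set \<Rightarrow> real ^ 'n \<Rightarrow> 'd \<Rightarrow> real" where
  "submat_tmult X M u = (\<lambda>k\<in>M. \<Sum>i\<in>UNIV. X $ i $ k * u $ i)"

definition full_column_rank :: "real ^ 'd ^ 'n \<Rightarrow> 'd set \<Rightarrow> bool" where
  "full_column_rank X M \<longleftrightarrow> dim ((\<lambda>k. column k X) ` M) = card M"

text \<open>The supremum norm on \<open>\<real>\<^sup>A\<close>; it is \<open>0\<close> if \<open>A\<close> is empty.\<close>

definition sup_norm_on :: "'d set \<Rightarrow> ('d \<Rightarrow> real) \<Rightarrow> real" where
  "sup_norm_on A w = Max (insert 0 ((\<lambda>k. \<bar>w k\<bar>) ` A))"

definition entrywise :: "(real \<Rightarrow> real) \<Rightarrow> real ^ 'n \<Rightarrow> real ^ 'n" where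
  "entrywise f u = (\<chi> i. f (u $ i))"


section \<open>The generalized linear lasso\<close>

definition responses :: "real set \<Rightarrow> (real ^ 'n) set" where
  "responses \<Y> = {Y. \<forall>i. Y $ i \<in> \<Y>}"

definition lasso_objective ::
  "real ^ 'd ^ 'n \<Rightarrow> (real \<Rightarrow> real) \<Rightarrow> real \<Rightarrow> real ^ 'n \<Rightarrow> real ^ 'd \<Rightarrow> real" where
  "lasso_objective X \<xi> lam Y \<theta> =
     (\<Sum>i\<in>UNIV. \<xi> (row i X \<bullet> \<theta>) - Y $ i * (row i X \<bullet> \<theta>)) + lam * (\<Sum>k\<in>UNIV. \<bar>\<theta> $ k\<bar>)"

definition lasso_solution ::
  "real ^ 'd ^ 'n \<Rightarrow> (real ^ 'd) set \<Rightarrow> (real \<Rightarrow> real) \<Rightarrow> real \<Rightarrow> real ^ 'n \<Rightarrow> real ^ 'd \<Rightarrow> bool" where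
  "lasso_solution X \<Theta> \<xi> lam Y \<theta> \<longleftrightarrow> is_arg_min (lasso_objective X \<xi> lam Y) (\<lambda>b. b \<in> \<Theta>) \<theta>"

definition kkt ::
  "real ^ 'd ^ 'n \<Rightarrow> (real \<Rightarrow> real) \<Rightarrow> real \<Rightarrow> real ^ 'n \<Rightarrow> real ^ 'd \<Rightarrow> real ^ 'd \<Rightarrow> bool" where
  "kkt X \<xi> lam Y \<theta> S \<longleftrightarrow>
     transpose X *v (Y - entrywise (deriv \<xi>) (X *v \<theta>)) = lam *\<^sub>R S \<and>
     (\<forall>k. \<theta> $ k \<noteq> 0 \<longrightarrow> S $ k = sgn (\<theta> $ k)) \<and>
     (\<forall>k. \<theta> $ k = 0 \<longrightarrow> S $ k \<in> {-1..1})"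

text \<open>The vector \<open>S(Y)\<close>, computed from some chosen solution; by the lemma \<open>subgrad_unique\<close> below
  it does not depend on the choice.\<close>

definition subgrad ::
  "real ^ 'd ^ 'n \<Rightarrow> (real ^ 'd) set \<Rightarrow> (real \<Rightarrow> real) \<Rightarrow> real \<Rightarrow> real ^ 'n \<Rightarrow> real ^ 'd" where
  "subgrad X \<Theta> \<xi> lam Y =
     (1 / lam) *\<^sub>R (transpose X *v
       (Y - entrywise (deriv \<xi>) (X *v (SOME \<theta>. lasso_solution X \<Theta> \<xi> lam Y \<theta>))))"

lemma deriv_strict_mono:
  assumes "strictly_convex f" and "\<And>x. f differentiable (at x)" and "x < y"
  shows "deriv f x < deriv f y"
proof -
  have D: "(f has_real_derivative deriv f z) (at z)" for z
    using assms(2)[of z] by (simp add: DERIV_deriv_iff_real_differentiable)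
  have cvx: "convex_on UNIV f"
  proof (rule convex_onI)
    fix t a b :: real
    assume "0 < t" "t < 1"
    then show "f ((1 - t) *\<^sub>R a + t *\<^sub>R b) \<le> (1 - t) * f a + t * f b"
      using assms(1) unfolding strictly_convex_def
      by (cases "a = b") (auto simp: algebra_simps intro!: less_imp_le)
  qed simp
  have tangent: "f b - f a \<ge> deriv f a * (b - a)" for a b
    using convex_on_imp_above_tangent[OF cvx, of a b "deriv f a"] D[of a] by simp
  define c where "c = (x + y) / 2"
  have mid: "f c < (f x + f y) / 2"
    using assms(1)[unfolded strictly_convex_def, rule_format, of x y "1/2"] assms(3)
    unfolding c_def by (simp add: add_divide_distrib)
  have "(deriv f y - deriv f x) * (y - x) > 0"
    using mid tangent[of x c] tangent[of y c]
    unfolding c_def by (simp add: field_simps)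
  then show ?thesis
    using assms(3) by (simp add: zero_less_mult_iff)
qed

lemma C_class_Suc_differentiable:
  assumes "C_class (m + 1) f"
  shows "f differentiable (at x)"
  using assms unfolding C_class_def by (auto dest: spec[of _ 0])

lemma kkt_fit_unique:
  assumes lam: "lam > 0" and cvx: "strictly_convex \<xi>" and diff: "\<And>x. \<xi> differentiable (at x)"
    and kkt: "kkt X \<xi> lam Y \<theta> S" "kkt X \<xi> lam Y \<theta>' S'"
  shows "X *v \<theta> = X *v \<theta>'"
proof -
  define u where "u = X *v \<theta>"
  define u' where "u' = X *v \<theta>'"
  have sub: "(\<theta> $ k - \<theta>' $ k) * (S $ k - S' $ k) \<ge> 0" for k
  proof -
    have "(\<theta> $ k \<noteq> 0 \<longrightarrow> S $ k = sgn (\<theta> $ k))" "(\<theta> $ k = 0 \<longrightarrow> S $ k \<in> {-1..1})"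
      "(\<theta>' $ k \<noteq> 0 \<longrightarrow> S' $ k = sgn (\<theta>' $ k))" "(\<theta>' $ k = 0 \<longrightarrow> S' $ k \<in> {-1..1})"
      using kkt unfolding kkt_def by auto
    then show ?thesis
      by (auto simp: sgn_if zero_le_mult_iff split: if_splits)
  qed
  have "(u - u') \<bullet> (entrywise (deriv \<xi>) u - entrywise (deriv \<xi>) u')
      = (X *v (\<theta> - \<theta>')) \<bullet> ((Y - entrywise (deriv \<xi>) u') - (Y - entrywise (deriv \<xi>) u))"
    by (simp add: u_def u'_def matrix_vector_mult_diff_distrib algebra_simps)
  also have "\<dots> = (\<theta> - \<theta>') \<bullet>
      (transpose X *v ((Y - entrywise (deriv \<xi>) u') - (Y - entrywise (deriv \<xi>) u)))"
    by (metis dot_lmul_matrix inner_commute transpose_matrix_vector)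
  also have "\<dots> = (\<theta> - \<theta>') \<bullet> (lam *\<^sub>R S' - lam *\<^sub>R S)"
    using kkt unfolding kkt_def u_def u'_def
    by (simp only: matrix_vector_mult_diff_distrib[of "transpose X" "Y - _" "Y - _"])
  also have "\<dots> = - (lam * (\<Sum>k\<in>UNIV. (\<theta> $ k - \<theta>' $ k) * (S $ k - S' $ k)))"
    by (simp add: inner_vec_def sum_distrib_left sum_negf[symmetric] algebra_simps)
  also have "\<dots> \<le> 0"
    using lam sub by (simp add: sum_nonneg)
  finally have le: "(\<Sum>i\<in>UNIV. (u $ i - u' $ i) * (deriv \<xi> (u $ i) - deriv \<xi> (u' $ i))) \<le> 0"
    by (simp add: inner_vec_def entrywise_def)
  have pos: "(a - b) * (deriv \<xi> a - deriv \<xi> b) > 0" if "a \<noteq> b" for a b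
    using that deriv_strict_mono[OF cvx diff, of a b] deriv_strict_mono[OF cvx diff, of b a]
    by (cases "a < b") (auto simp: zero_less_mult_iff)
  then have nn: "(a - b) * (deriv \<xi> a - deriv \<xi> b) \<ge> 0" for a b
    by (cases "a = b") (auto intro: less_imp_le)
  have "(\<Sum>i\<in>UNIV. (u $ i - u' $ i) * (deriv \<xi> (u $ i) - deriv \<xi> (u' $ i))) = 0"
    using le by (intro antisym sum_nonneg nn)
  then have "(u $ i - u' $ i) * (deriv \<xi> (u $ i) - deriv \<xi> (u' $ i)) = 0" for i
    using nn by (simp add: sum_nonneg_eq_0_iff)
  then have "u = u'"
    using pos by (metis less_irrefl vec_eq_iff)
  then show ?thesis
    by (simp add: u_def u'_def)
qed

lemma subgrad_unique:
  assumes "lam > 0" and "C_class (m + 1) \<xi>" and "strictly_convex \<xi>"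
    and kkt: "\<And>\<eta>. lasso_solution X \<Theta> \<xi> lam Y \<eta> \<longleftrightarrow> \<eta> \<in> \<Theta> \<and> (\<exists>S. kkt X \<xi> lam Y \<eta> S)"
    and sol: "lasso_solution X \<Theta> \<xi> lam Y \<theta>"
  shows "subgrad X \<Theta> \<xi> lam Y =
    (1 / lam) *\<^sub>R (transpose X *v (Y - entrywise (deriv \<xi>) (X *v \<theta>)))"
proof -
  have "lasso_solution X \<Theta> \<xi> lam Y (SOME \<theta>. lasso_solution X \<Theta> \<xi> lam Y \<theta>)"
    using sol by (rule someI)
  then have "X *v (SOME \<theta>. lasso_solution X \<Theta> \<xi> lam Y \<theta>) = X *v \<theta>"
    using kkt sol kkt_fit_unique[OF assms(1,3) C_class_Suc_differentiable[OF assms(2)]] by metis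
  then show ?thesis
    by (simp add: subgrad_def)
qed

text \<open>The equicorrelation set need not be the support of a solution; the two agree if
  \<open>\<bar>S\<^sub>k(Y)\<bar> < 1\<close> whenever the \<open>k\<close>-th entry of the solution vanishes.\<close>

definition equicorrelation_set ::
  "real ^ 'd ^ 'n \<Rightarrow> (real ^ 'd) set \<Rightarrow> (real \<Rightarrow> real) \<Rightarrow> real \<Rightarrow> real ^ 'n \<Rightarrow> 'd set" where
  "equicorrelation_set X \<Theta> \<xi> lam Y = {k. \<bar>subgrad X \<Theta> \<xi> lam Y $ k\<bar> = 1}"

definition selection_event ::
  "real ^ 'd ^ 'n \<Rightarrow> (real ^ 'd) set \<Rightarrow> real set \<Rightarrow> (real \<Rightarrow> real) \<Rightarrow> real \<Rightarrow> 'd set \<Rightarrow> (real ^ 'n) set"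
  where
  "selection_event X \<Theta> \<Y> \<xi> lam M =
     {Y \<in> responses \<Y>. equicorrelation_set X \<Theta> \<xi> lam Y = M}"

definition signed_selection_event ::
  "real ^ 'd ^ 'n \<Rightarrow> (real ^ 'd) set \<Rightarrow> real set \<Rightarrow> (real \<Rightarrow> real) \<Rightarrow> real \<Rightarrow> 'd set \<Rightarrow>
    ('d \<Rightarrow> real) \<Rightarrow> (real ^ 'n) set" where
  "signed_selection_event X \<Theta> \<Y> \<xi> lam M S\<^sub>M =
     {Y \<in> selection_event X \<Theta> \<Y> \<xi> lam M. subvec M (subgrad X \<Theta> \<xi> lam Y) = S\<^sub>M}"

definition subparams :: "(real ^ 'd) set \<Rightarrow> 'd set \<Rightarrow> ('d \<Rightarrow> real) set" where
  "subparams \<Theta> M = subvec M ` \<Theta>"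

definition Xi_map ::
  "real ^ 'd ^ 'n \<Rightarrow> (real \<Rightarrow> real) \<Rightarrow> 'd set \<Rightarrow> ('d \<Rightarrow> real) \<Rightarrow> 'd \<Rightarrow> real" where
  "Xi_map X \<xi> M \<eta> = submat_tmult X M (entrywise (deriv \<xi>) (submat_mult X M \<eta>))"

definition Psi_map ::
  "real ^ 'd ^ 'n \<Rightarrow> (real ^ 'd) set \<Rightarrow> (real \<Rightarrow> real) \<Rightarrow> 'd set \<Rightarrow> ('d \<Rightarrow> real) \<Rightarrow> 'd \<Rightarrow> real" where
  "Psi_map X \<Theta> \<xi> M = the_inv_into (subparams \<Theta> M) (Xi_map X \<xi> M)"

end

(* A solution supported on M satisfies X \<theta> = X_M \<theta>_M, and the KKT conditions restricted to M say
   \<Xi>(\<theta>_M) = \<rho>. Conversely, padding \<Psi>(\<rho>) with zeros gives a vector satisfying the KKT conditions.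
   It need not lie in \<Theta>, but uniqueness of the fit X \<theta> does not require that, so its subgradient
   agrees with the one of any solution in \<Theta>. *)

theory Submission
  imports Defs
begin

text \<open>Extension by zero embeds the families indexed by \<open>M\<close> into the full
  parameter space, so that products with the submatrix of columns in \<open>M\<close> become
  ordinary products with \<open>X\<close>.\<close>

definition zero_pad :: "'d set \<Rightarrow> ('d \<Rightarrow> real) \<Rightarrow> real ^ 'd" where
  "zero_pad M \<eta> = (\<chi> k. if k \<in> M then \<eta> k else 0)"

lemma zero_pad_nth [simp]: "zero_pad M \<eta> $ k = (if k \<in> M then \<eta> k else 0)"
  by (simp add: zero_pad_def)

lemma submat_mult_zero_pad: "submat_mult X M \<eta> = X *v zero_pad M \<eta>"
  by (simp add: vec_eq_iff submat_mult_def matrix_vector_mult_def if_distrib sum.If_cases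
      cong: if_cong)

lemma submat_tmult_nth:
  "k \<in> M \<Longrightarrow> submat_tmult X M u k = (transpose X *v u) $ k"
  by (simp add: submat_tmult_def matrix_vector_mult_def transpose_def)

lemma zero_pad_subvec:
  assumes "\<And>k. k \<notin> M \<Longrightarrow> \<theta> $ k = 0"
  shows "zero_pad M (subvec M \<theta>) = \<theta>"
  using assms by (simp add: vec_eq_iff subvec_def)

text \<open>Positivity of \<open>c\<close> absorbs the \<open>0\<close> inserted into the maximum,
  so empty \<open>A\<close> is covered.\<close>

lemma sup_norm_on_less_iff:
  fixes A :: "'d::finite set"
  assumes "c > 0"
  shows "sup_norm_on A w < c \<longleftrightarrow> (\<forall>k\<in>A. \<bar>w k\<bar> < c)"
  using assms by (simp add: sup_norm_on_def)

text \<open>The inner product is a sum of terms \<open>(a - b) * (f a - f b)\<close>, each positive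
  unless \<open>a = b\<close>; a zero sum makes every term vanish.\<close>

lemma entrywise_inner_monotone_eq:
  assumes "\<And>a b. a < b \<Longrightarrow> f a < (f b :: real)"
    and "(u - u') \<bullet> (entrywise f u - entrywise f u') = 0"
  shows "u = u'"
proof -
  have pos: "(a - b) * (f a - f b) > 0" if "a \<noteq> b" for a b
    using that assms(1)[of a b] assms(1)[of b a]
    by (cases "a < b") (auto simp: zero_less_mult_iff)
  then have "(a - b) * (f a - f b) \<ge> 0" for a b
    by (cases "a = b") (auto intro: less_imp_le)
  moreover have "(\<Sum>i\<in>UNIV. (u $ i - u' $ i) * (f (u $ i) - f (u' $ i))) = 0"
    using assms(2) by (simp add: inner_vec_def entrywise_def)
  ultimately have "(u $ i - u' $ i) * (f (u $ i) - f (u' $ i)) = 0" for i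
    by (simp add: sum_nonneg_eq_0_iff)
  then show ?thesis
    using pos by (metis less_irrefl vec_eq_iff)
qed

text \<open>The vector \<open>X *v w\<close> is a combination of the columns indexed by
  \<open>M\<close>. The rank condition only fixes the dimension of their span, so distinctness and
  independence of these columns are derived first.\<close>

lemma full_column_rank_kernel:
  fixes X :: "real ^ 'd ^ 'n"
  assumes rank: "full_column_rank X M" and supp: "\<And>k. k \<notin> M \<Longrightarrow> w $ k = 0"
    and zero: "X *v w = 0"
  shows "w = 0"
proof -
  let ?c = "\<lambda>k. column k X"
  have dim: "dim (?c ` M) = card M"
    using rank by (simp add: full_column_rank_def)
  \<comment> \<open>Sandwich: the dimension is at most the number of distinct columns, which is at
    most \<open>card M\<close>.\<close>
  have "card (?c ` M) = card M"
    using dim dim_le_card[of "?c ` M" "?c ` M"] card_image_le[of M ?c] span_superset[of "?c ` M"]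
    by simp
  then have inj: "inj_on ?c M"
    by (simp add: inj_on_iff_eq_card)
  have indep: "independent (?c ` M)"
    using dim \<open>card (?c ` M) = card M\<close>
    by (metis card_le_dim_spanning finite finite_imageI order_refl span_superset)
  have "(\<Sum>k\<in>M. w $ k *\<^sub>R ?c k) = (\<Sum>k\<in>UNIV. w $ k *\<^sub>R ?c k)"
    using supp by (intro sum.mono_neutral_left) auto
  also have "\<dots> = 0"
    using zero by (simp add: matrix_mult_sum scalar_mult_eq_scaleR)
  \<comment> \<open>Independence concerns sets of vectors, so the sum over indices is rewritten over
    columns; \<open>inv_into\<close> recovers the index of a column.\<close>
  finally have "(\<Sum>x\<in>?c ` M. w $ inv_into M ?c x *\<^sub>R x) = 0"
    using inj by (simp add: sum.reindex inv_into_f_f[of ?c M] cong: sum.cong)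
  then have "w $ inv_into M ?c x = 0" if "x \<in> ?c ` M" for x
    using indep that independentD[of "?c ` M" "?c ` M" "\<lambda>x. w $ inv_into M ?c x" x] by simp
  then have "w $ k = 0" if "k \<in> M" for k
    using inj that by (metis image_eqI inv_into_f_f)
  then show ?thesis
    using supp by (metis vec_eq_iff zero_index)
qed

text \<open>Equal images make the difference of the \<open>deriv \<xi>\<close> values orthogonal to
  all columns in \<open>M\<close>, hence to the difference of the fits. Strict monotonicity then
  equates the fits, and full rank equates the parameters. The domain is \<open>extensional M\<close>
  because values outside \<open>M\<close> do not influence \<open>Xi_map\<close>.\<close>

lemma Xi_map_inj_on:
  fixes X :: "real ^ 'd ^ 'n"
  assumes mono: "\<And>a b. a < b \<Longrightarrow> deriv \<xi> a < deriv \<xi> b" and rank: "full_column_rank X M"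
  shows "inj_on (Xi_map X \<xi> M) (extensional M)"
proof (rule inj_onI)
  fix \<eta> \<eta>' assume ext: "\<eta> \<in> extensional M" "\<eta>' \<in> extensional M"
    and eq: "Xi_map X \<xi> M \<eta> = Xi_map X \<xi> M \<eta>'"
  define w where "w = zero_pad M \<eta> - zero_pad M \<eta>'"
  define u u' where "u = X *v zero_pad M \<eta>" and "u' = X *v zero_pad M \<eta>'"
  let ?g = "entrywise (deriv \<xi>) u - entrywise (deriv \<xi>) u'"
  have "(transpose X *v ?g) $ k = 0" if "k \<in> M" for k
    using fun_cong[OF eq, of k] that
    by (simp add: Xi_map_def submat_mult_zero_pad submat_tmult_nth u_def u'_def
        matrix_vector_mult_diff_distrib)
  \<comment> \<open>Complementary supports: \<open>w\<close> vanishes off \<open>M\<close>, the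
    other factor on \<open>M\<close>.\<close>
  then have "w \<bullet> (transpose X *v ?g) = 0"
    by (auto simp: inner_vec_def w_def intro!: sum.neutral)
  moreover have "(u - u') \<bullet> ?g = w \<bullet> (transpose X *v ?g)"
    unfolding u_def u'_def w_def matrix_vector_mult_diff_distrib[symmetric]
    by (metis dot_lmul_matrix inner_commute transpose_matrix_vector)
  ultimately have "u = u'"
    using entrywise_inner_monotone_eq[OF mono] by simp
  then have "X *v w = 0"
    by (simp add: w_def u_def u'_def matrix_vector_mult_diff_distrib)
  then have "w = 0"
    by (intro full_column_rank_kernel[OF rank]) (auto simp: w_def)
  show "\<eta> = \<eta>'"
  proof (rule extensionalityI[OF ext])
    fix k assume "k \<in> M"
    then show "\<eta> k = \<eta>' k"
      using arg_cong[OF \<open>w = 0\<close>, of "\<lambda>w. w $ k"] by (simp add: w_def)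
  qed
qed

lemma Psi_map_Xi_map:
  fixes X :: "real ^ 'd ^ 'n"
  assumes "\<And>a b. a < b \<Longrightarrow> deriv \<xi> a < deriv \<xi> b" and "full_column_rank X M"
    and "\<eta> \<in> subparams \<Theta> M"
  shows "Psi_map X \<Theta> \<xi> M (Xi_map X \<xi> M \<eta>) = \<eta>"
proof -
  have "subparams \<Theta> M \<subseteq> extensional M"
    by (auto simp: subparams_def subvec_def)
  then have "inj_on (Xi_map X \<xi> M) (subparams \<Theta> M)"
    using Xi_map_inj_on[OF assms(1,2)] inj_on_subset by blast
  then show ?thesis
    unfolding Psi_map_def using assms(3) by (rule the_inv_into_f_f)
qed

theorem theorem1:
  fixes X :: "real ^ 'd ^ 'n"
    and \<Theta> :: "(real ^ 'd) set"
    and \<Y> :: "real set"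
    and \<nu> :: "real measure"
    and h :: "real \<Rightarrow> real"
    and v lam :: real
    and \<xi> :: "real \<Rightarrow> real"
    and m s :: nat
    and M :: "'d set"
    and S\<^sub>M :: "'d \<Rightarrow> real"
  assumes "lam > 0" and "v > 0"
    and "C_class (m + 1) \<xi>"
    and "partition_function \<Y> \<nu> h v \<xi>"
    and "\<And>Y. Y \<in> responses \<Y> \<Longrightarrow> \<exists>\<theta>. lasso_solution X \<Theta> \<xi> lam Y \<theta>"
    and "\<And>Y \<theta>. Y \<in> responses \<Y> \<Longrightarrow>
           lasso_solution X \<Theta> \<xi> lam Y \<theta> \<longleftrightarrow> \<theta> \<in> \<Theta> \<and> (\<exists>S. kkt X \<xi> lam Y \<theta> S)"
    and "strictly_convex \<xi>"
    and "card M = s"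
    and "full_column_rank X M"
    and "S\<^sub>M \<in> M \<rightarrow>\<^sub>E {-1, 1}"
  shows "signed_selection_event X \<Theta> \<Y> \<xi> lam M S\<^sub>M =
    {Y \<in> responses \<Y>.
       let \<rho> = (\<lambda>k\<in>M. - lam * S\<^sub>M k + submat_tmult X M Y k);
           \<psi> = Psi_map X \<Theta> \<xi> M \<rho>
       in \<rho> \<in> Xi_map X \<xi> M ` subparams \<Theta> M \<and>
          (\<forall>k\<in>M. S\<^sub>M k * \<psi> k \<ge> 0) \<and>
          sup_norm_on (- M)
            (submat_tmult X (- M) (Y - entrywise (deriv \<xi>) (submat_mult X M \<psi>))) < lam}"
proof -
  have mono: "deriv \<xi> a < deriv \<xi> b" if "a < b" for a b
    using deriv_strict_mono[OF assms(7) C_class_Suc_differentiable[OF assms(3)] that] .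
  note Psi = Psi_map_Xi_map[OF mono assms(9)]
  define R where "R Y = (\<lambda>k\<in>M. - lam * S\<^sub>M k + submat_tmult X M Y k)" for Y
  \<comment> \<open>\<open>G\<close> is minus the gradient of the unpenalized part of the objective,
    the left side of the KKT equation.\<close>
  define G where "G Y \<theta> = transpose X *v (Y - entrywise (deriv \<xi>) (X *v \<theta>))" for Y \<theta>
  \<comment> \<open>Solving for a preimage of \<rho> amounts to the KKT equation on \<open>M\<close>
    for the padded vector.\<close>
  have Xi_eq_iff: "Xi_map X \<xi> M \<eta> = R Y \<longleftrightarrow> (\<forall>k\<in>M. G Y (zero_pad M \<eta>) $ k = lam * S\<^sub>M k)" for \<eta> Y
  proof -
    have "Xi_map X \<xi> M \<eta> \<in> extensional M" "R Y \<in> extensional M"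
      by (auto simp: Xi_map_def submat_tmult_def R_def)
    then have "Xi_map X \<xi> M \<eta> = R Y \<longleftrightarrow> (\<forall>k\<in>M. Xi_map X \<xi> M \<eta> k = R Y k)"
      by (auto intro: extensionalityI)
    also have "\<dots> \<longleftrightarrow> (\<forall>k\<in>M. G Y (zero_pad M \<eta>) $ k = lam * S\<^sub>M k)"
      by (intro ball_cong) (auto simp: Xi_map_def R_def G_def submat_mult_zero_pad
          submat_tmult_nth matrix_vector_mult_diff_distrib)
    finally show ?thesis .
  qed
  \<comment> \<open>Condition (c) is the strict subgradient bound off \<open>M\<close> for the
    padded vector.\<close>
  have norm_iff: "sup_norm_on (- M)
      (submat_tmult X (- M) (Y - entrywise (deriv \<xi>) (submat_mult X M \<eta>))) < lam \<longleftrightarrow>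
      (\<forall>k. k \<notin> M \<longrightarrow> \<bar>G Y (zero_pad M \<eta>) $ k\<bar> < lam)" for Y \<eta>
    by (auto simp: sup_norm_on_less_iff[OF assms(1)] submat_tmult_nth submat_mult_zero_pad G_def)
  have pm1: "S\<^sub>M k = 1 \<or> S\<^sub>M k = -1" if "k \<in> M" for k
    using assms(10) that by auto
  have ext: "S\<^sub>M \<in> extensional M"
    using assms(10) by (simp add: PiE_def)
  have "Y \<in> signed_selection_event X \<Theta> \<Y> \<xi> lam M S\<^sub>M \<longleftrightarrow>
      R Y \<in> Xi_map X \<xi> M ` subparams \<Theta> M \<and>
      (\<forall>k\<in>M. S\<^sub>M k * Psi_map X \<Theta> \<xi> M (R Y) k \<ge> 0) \<and>
      sup_norm_on (- M) (submat_tmult X (- M)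
        (Y - entrywise (deriv \<xi>) (submat_mult X M (Psi_map X \<Theta> \<xi> M (R Y))))) < lam"
    (is "?E \<longleftrightarrow> ?a \<and> ?b \<and> ?c") if Y: "Y \<in> responses \<Y>" for Y
  proof -
    obtain \<theta> S where sol: "lasso_solution X \<Theta> \<xi> lam Y \<theta>" and \<theta>: "\<theta> \<in> \<Theta>" "kkt X \<xi> lam Y \<theta> S"
      using assms(5,6) Y by metis
    have G_eq: "G Y \<theta> = lam *\<^sub>R S"
      using \<theta>(2) by (simp add: kkt_def G_def)
    \<comment> \<open>The event can now be read off the KKT witness \<open>S\<close> of one fixed
      solution.\<close>
    have subgrad: "subgrad X \<Theta> \<xi> lam Y = S"
      using subgrad_unique[OF assms(1,3,7) assms(6)[OF Y] sol] G_eq assms(1) by (simp add: G_def)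
    have E_iff: "?E \<longleftrightarrow> {k. \<bar>S $ k\<bar> = 1} = M \<and> subvec M S = S\<^sub>M"
      using Y by (simp add: signed_selection_event_def selection_event_def
          equicorrelation_set_def subgrad)
    have bound: "\<bar>S $ k\<bar> \<le> 1" and sign: "\<theta> $ k \<noteq> 0 \<Longrightarrow> S $ k = sgn (\<theta> $ k)" for k
      using \<theta>(2) by (cases "\<theta> $ k = 0"; auto simp: kkt_def sgn_if abs_le_iff)+
    show ?thesis
    proof
      assume ?E
      then have M: "\<bar>S $ k\<bar> = 1 \<longleftrightarrow> k \<in> M" and S\<^sub>M: "k \<in> M \<Longrightarrow> S $ k = S\<^sub>M k" for k
        using E_iff by (auto simp: subvec_def)
      \<comment> \<open>A nonzero coordinate would have a subgradient entry of modulus 1 and so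
        belong to \<open>M\<close>.\<close>
      have "\<theta> $ k = 0" if "k \<notin> M" for k
        using M[of k] sign[of k] that by (cases "\<theta> $ k = 0") (auto simp: sgn_if split: if_splits)
      then have pad: "zero_pad M (subvec M \<theta>) = \<theta>"
        by (rule zero_pad_subvec)
      have sub: "subvec M \<theta> \<in> subparams \<Theta> M"
        using \<theta>(1) by (simp add: subparams_def)
      have Xi: "Xi_map X \<xi> M (subvec M \<theta>) = R Y"
        using S\<^sub>M by (simp add: Xi_eq_iff pad G_eq)
      have psi: "Psi_map X \<Theta> \<xi> M (R Y) = subvec M \<theta>"
        using Psi[OF _ sub] Xi by simp
      have ?a
        using sub Xi by (metis image_eqI)
      moreover have ?b
      proof
        fix k assume "k \<in> M"
        then show "S\<^sub>M k * Psi_map X \<Theta> \<xi> M (R Y) k \<ge> 0"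
          \<comment> \<open>A zero coordinate inside \<open>M\<close> gives product 0; otherwise the
            entry of \<open>S\<close> is the sign of the coordinate.\<close>
          using S\<^sub>M[of k] sign[of k]
          by (cases "\<theta> $ k = 0")
            (auto simp: psi subvec_def sgn_if zero_le_mult_iff split: if_splits)
      qed
      moreover have ?c
      proof -
        have "\<bar>S $ k\<bar> < 1" if "k \<notin> M" for k
          using M[of k] bound[of k] that by linarith
        then show ?thesis
          using assms(1) by (simp add: norm_iff psi pad G_eq abs_mult)
      qed
      ultimately show "?a \<and> ?b \<and> ?c" by blast
    next
      assume R: "?a \<and> ?b \<and> ?c"
      then obtain \<eta> where \<eta>: "\<eta> \<in> subparams \<Theta> M" "Xi_map X \<xi> M \<eta> = R Y"
        by force
      have psi: "Psi_map X \<Theta> \<xi> M (R Y) = \<eta>"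
        using Psi[OF _ \<eta>(1)] \<eta>(2) by simp
      define \<theta>' where "\<theta>' = zero_pad M \<eta>"
      \<comment> \<open>This choice makes the KKT equation automatic; only the sign and bound
        conditions remain.\<close>
      define S' where "S' = (1 / lam) *\<^sub>R G Y \<theta>'"
      have in_M: "S' $ k = S\<^sub>M k" if "k \<in> M" for k
        using \<eta>(2) assms(1) that by (simp add: Xi_eq_iff S'_def \<theta>'_def)
      have off_M: "\<bar>S' $ k\<bar> < 1" if "k \<notin> M" for k
        using R assms(1) that by (simp add: norm_iff psi S'_def \<theta>'_def abs_mult)
      have signs: "S\<^sub>M k * \<eta> k \<ge> 0" if "k \<in> M" for k
        using R psi that by simp
      have kkt': "kkt X \<xi> lam Y \<theta>' S'"
        unfolding kkt_def
      proof (intro conjI allI impI)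
        show "transpose X *v (Y - entrywise (deriv \<xi>) (X *v \<theta>')) = lam *\<^sub>R S'"
          using assms(1) by (simp add: S'_def G_def)
      next
        fix k assume "\<theta>' $ k \<noteq> 0"
        then have "k \<in> M" "\<eta> k \<noteq> 0" by (auto simp: \<theta>'_def split: if_splits)
        \<comment> \<open>A number in {-1, 1} whose product with a nonzero real is nonnegative is
          the sign of that real.\<close>
        then show "S' $ k = sgn (\<theta>' $ k)"
          using pm1[of k] signs[of k] in_M[of k] by (auto simp: \<theta>'_def sgn_if)
      next
        fix k
        show "S' $ k \<in> {-1..1}"
          using pm1[of k] in_M[of k] off_M[of k] by (cases "k \<in> M") auto
      qed
      have "X *v \<theta> = X *v \<theta>'"
        using kkt_fit_unique[OF assms(1,7) C_class_Suc_differentiable[OF assms(3)] \<theta>(2) kkt'] .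
      \<comment> \<open>Both are \<open>G\<close> divided by \<open>lam\<close>, and
        \<open>G\<close> depends on the parameter only through the fit.\<close>
      then have "S = S'"
        using G_eq assms(1) by (simp add: S'_def G_def)
      \<comment> \<open>The strict inequality in (c) keeps indices outside \<open>M\<close> out of
        the equicorrelation set.\<close>
      moreover have "{k. \<bar>S' $ k\<bar> = 1} = M"
        using pm1 in_M off_M by force
      moreover have "subvec M S' = S\<^sub>M"
        using in_M ext by (auto simp: subvec_def fun_eq_iff extensional_def)
      ultimately show ?E
        using E_iff by simp
    qed
  qed
  then show ?thesis
    unfolding Let_def R_def by (auto simp: signed_selection_event_def selection_event_def)
qed

end
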